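(* Let $(A,B)$ be a pair of real random variables with $\mathbb{P}(A<0)>0$, $\mathbb{E}\log|A|<0$ and $\mathbb{E}\log^+|B|<\infty$. Let $R$ be the solution of $R\stackrel{d}{=}AR+B$, with $R$ and $(A,B)$ independent. Then $R$ is also a solution of $$R\stackrel{d}{=}A_1\cdots A_N\,R+R_N^{*},\qquad R\text{ and }(A_1\cdots A_N,R_N^{*})\text{ independent},$$ where $$R_N^{*}\stackrel{d}{=}(-A_-)S+B,\qquad S\text{ and }(A_-,B)\text{ independent},$$ and $S$ satisfies $$S\stackrel{d}{=}A_+S+B,\qquad S\text{ and }(A_+,B)\text{ independent}.$$
   Context: $(A_n,B_n)_{n\ge1}$ are i.i.d. copies of $(A,B)$. $\Pi_n=A_1\cdots A_n$, and $N=\inf\{n\in\mathbb{N}:\Pi_n\ge0\}$ with $\mathbb{N}=\{1,2,\dots\}$ ($N$ is an a.s. finite stopping time with respect to $\mathcal{F}_n=\sigma((A_k,B_k)_{k=1}^n)$). $R_n^{*}=B_1+A_1B_2+\dots+A_1\cdots A_{n-1}B_n$ for $n\ge1$, and $R_N^*$ is its value at $n=N$. $A_+=A\mathbf{1}_{\{A\ge0\}}$, $A_-=-A\mathbf{1}_{\{A<0\}}$. Equations for $R$ and $S$ are equations in law, whose solutions are unique in law under the stated assumptions. *)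

theory Defs
  imports "HOL-Probability.Probability"
begin

section \<open>Expectations with values in the extended reals\<close>

text \<open>The library has \<open>ln 0 = 0\<close>; here the logarithm of the modulus is \<open>-\<infinity>\<close> at 0.\<close>

definition log_abs :: "real \<Rightarrow> ereal" where
  "log_abs x = (if x = 0 then -\<infinity> else ereal (ln \<bar>x\<bar>))"

text \<open>
  The expectation \<open>E X\<^sup>+ - E X\<^sup>-\<close>. Since \<open>\<infinity> - \<infinity> = \<infinity>\<close> on \<^typ>\<open>ereal\<close>, a bound
  \<open>ext_expectation M X < c\<close> includes \<open>E X\<^sup>+ < \<infinity>\<close>, so that the expectation is
  well defined, possibly \<open>-\<infinity>\<close>. (\<^const>\<open>e2ennreal\<close> sends negative arguments to 0.)
\<close>

definition ext_expectation :: "'a measure \<Rightarrow> ('a \<Rightarrow> ereal) \<Rightarrow> ereal" where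
  "ext_expectation M X =
     enn2ereal (\<integral>\<^sup>+ \<omega>. e2ennreal (X \<omega>) \<partial>M) - enn2ereal (\<integral>\<^sup>+ \<omega>. e2ennreal (- X \<omega>) \<partial>M)"


section \<open>Affine equations in law\<close>

definition joint_law ::
    "'a measure \<Rightarrow> ('a \<Rightarrow> real) \<Rightarrow> ('a \<Rightarrow> real) \<Rightarrow> (real \<times> real) measure" where
  "joint_law M U V = distr M (borel \<Otimes>\<^sub>M borel) (\<lambda>\<omega>. (U \<omega>, V \<omega>))"

text \<open>
  The law of \<open>U X + V\<close> for \<open>(U, V)\<close> with law \<open>\<nu>\<close> and \<open>X\<close> with law \<open>\<mu>\<close>, where \<open>X\<close> and
  \<open>(U, V)\<close> are independent: the product measure is the joint law of \<open>((U, V), X)\<close>;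
  see \<open>affine_law_indep\<close> below.
\<close>

definition affine_law :: "(real \<times> real) measure \<Rightarrow> real measure \<Rightarrow> real measure" where
  "affine_law \<nu> \<mu> = distr (\<nu> \<Otimes>\<^sub>M \<mu>) borel (\<lambda>((u, v), x). u * x + v)"

lemma (in prob_space) affine_law_indep:
  fixes U V X :: "'a \<Rightarrow> real"
  assumes [measurable]: "U \<in> borel_measurable M" "V \<in> borel_measurable M" "X \<in> borel_measurable M"
    and indep: "indep_set
      {(\<lambda>\<omega>. (U \<omega>, V \<omega>)) -` C \<inter> space M | C. C \<in> sets (borel \<Otimes>\<^sub>M borel)}
      {X -` D \<inter> space M | D. D \<in> sets borel}"
  shows "affine_law (joint_law M U V) (distr M borel X) = distr M borel (\<lambda>\<omega>. U \<omega> * X \<omega> + V \<omega>)"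
proof -
  interpret UV: prob_space "joint_law M U V"
    unfolding joint_law_def by (rule prob_space_distr) measurable
  interpret X: prob_space "distr M borel X"
    by (rule prob_space_distr) measurable
  have eq: "joint_law M U V \<Otimes>\<^sub>M distr M borel X
      = distr M ((borel \<Otimes>\<^sub>M borel) \<Otimes>\<^sub>M borel) (\<lambda>\<omega>. ((U \<omega>, V \<omega>), X \<omega>))"
  proof (rule pair_measure_eqI)
    show "sigma_finite_measure (joint_law M U V)" "sigma_finite_measure (distr M borel X)"
      by unfold_locales
    show "sets (joint_law M U V \<Otimes>\<^sub>M distr M borel X)
        = sets (distr M ((borel \<Otimes>\<^sub>M borel) \<Otimes>\<^sub>M borel) (\<lambda>\<omega>. ((U \<omega>, V \<omega>), X \<omega>)))"
      by (simp add: joint_law_def cong: sets_pair_measure_cong)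
  next
    fix C D assume "C \<in> sets (joint_law M U V)" "D \<in> sets (distr M borel X)"
    then have [measurable]: "C \<in> sets (borel \<Otimes>\<^sub>M borel)" "D \<in> sets borel"
      by (auto simp: joint_law_def)
    let ?C = "(\<lambda>\<omega>. (U \<omega>, V \<omega>)) -` C \<inter> space M" and ?D = "X -` D \<inter> space M"
    have "prob (?C \<inter> ?D) = prob ?C * prob ?D"
      by (rule indep_setD[OF indep]) auto
    moreover have "(\<lambda>\<omega>. ((U \<omega>, V \<omega>), X \<omega>)) -` (C \<times> D) \<inter> space M = ?C \<inter> ?D"
      by auto
    ultimately show "emeasure (joint_law M U V) C * emeasure (distr M borel X) D
        = emeasure (distr M ((borel \<Otimes>\<^sub>M borel) \<Otimes>\<^sub>M borel) (\<lambda>\<omega>. ((U \<omega>, V \<omega>), X \<omega>))) (C \<times> D)"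
      by (simp add: joint_law_def emeasure_distr emeasure_eq_measure ennreal_mult)
  qed
  have [measurable]: "(\<lambda>((u, v), x). u * x + v) \<in> borel_measurable
      ((borel \<Otimes>\<^sub>M borel) \<Otimes>\<^sub>M (borel :: real measure))"
    unfolding case_prod_unfold by measurable
  show ?thesis
    unfolding affine_law_def eq by (subst distr_distr) (auto simp: comp_def)
qed

text \<open>
  \<open>\<mu>\<close> is the law of a solution of \<open>X = U X + V\<close> in law, with \<open>X\<close> and \<open>(U, V)\<close>
  independent, where \<open>(U, V)\<close> has law \<open>\<nu>\<close>.
\<close>

definition solves_affine :: "(real \<times> real) measure \<Rightarrow> real measure \<Rightarrow> bool" where
  "solves_affine \<nu> \<mu> \<longleftrightarrow> real_distribution \<mu> \<and> \<mu> = affine_law \<nu> \<mu>"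


section \<open>Independent copies and the stopped backward iteration\<close>

text \<open>Sequences are indexed from 1; the values at index 0 are irrelevant.\<close>

definition iid_copies ::
    "'b measure \<Rightarrow> (nat \<Rightarrow> 'b \<Rightarrow> real) \<Rightarrow> (nat \<Rightarrow> 'b \<Rightarrow> real) \<Rightarrow> (real \<times> real) measure \<Rightarrow> bool" where
  "iid_copies P A B \<nu> \<longleftrightarrow>
     prob_space.indep_vars P (\<lambda>_. borel \<Otimes>\<^sub>M borel) (\<lambda>n \<omega>. (A n \<omega>, B n \<omega>)) {1..} \<and>
     (\<forall>n\<ge>1. joint_law P (A n) (B n) = \<nu>)"

definition Pi_n :: "(nat \<Rightarrow> 'b \<Rightarrow> real) \<Rightarrow> nat \<Rightarrow> 'b \<Rightarrow> real" where
  "Pi_n A n \<omega> = (\<Prod>k=1..n. A k \<omega>)"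

definition Rstar :: "(nat \<Rightarrow> 'b \<Rightarrow> real) \<Rightarrow> (nat \<Rightarrow> 'b \<Rightarrow> real) \<Rightarrow> nat \<Rightarrow> 'b \<Rightarrow> real" where
  "Rstar A B n \<omega> = (\<Sum>k=1..n. (\<Prod>j=1..<k. A j \<omega>) * B k \<omega>)"

text \<open>
  Where no such \<open>n\<close> exists, the infimum of the empty set of naturals is 0 instead of \<open>\<infinity>\<close>.
  This is immaterial for laws if the time is almost surely finite.
\<close>

definition stop_time :: "(nat \<Rightarrow> 'b \<Rightarrow> real) \<Rightarrow> 'b \<Rightarrow> nat" where
  "stop_time A \<omega> = Inf {n. 1 \<le> n \<and> 0 \<le> Pi_n A n \<omega>}"

definition plus_part :: "real \<Rightarrow> real" where
  "plus_part a = a * indicator {0..} a"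

definition minus_part :: "real \<Rightarrow> real" where
  "minus_part a = - a * indicator {..<0} a"

end

theory Submission
  imports Defs
begin

text \<open>
  If \<open>R\<close> has law \<open>\<mu> = affine_law \<nu> \<mu>\<close>, then \<open>h (a, b) = E f (a R + b)\<close> satisfies
  \<open>h x = E h (x \<circ> (A, B))\<close>, where \<open>\<circ>\<close> is the composition of affine maps; so \<open>h\<close>
  is a bounded martingale along \<open>(\<Pi>\<^sub>n, R\<^sup>*\<^sub>n)\<close>, and optional stopping at \<open>N\<close> gives the equation for \<open>R\<close>.
  For \<open>R\<^sup>*\<^sub>N\<close>, follow the chain whose slopes are \<open>-A\<^sub>-\<close> in the first step and \<open>A\<^sub>+\<close>
  afterwards: it agrees with \<open>(\<Pi>\<^sub>n, R\<^sup>*\<^sub>n)\<close> before \<open>N\<close>, and at \<open>N\<close> it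
  is absorbed at \<open>(0, R\<^sup>*\<^sub>N)\<close>, because \<open>A\<^sub>+\<close> (or \<open>-A\<^sub>-\<close>, if \<open>N = 1\<close>) vanishes there.
  The martingale argument for \<open>S\<close> in place of \<open>R\<close> then identifies the limit law.
  Finally, the chain with all slopes \<open>A\<^sub>+\<close> is almost surely eventually constant, and the law of
  its limit solves the equation for \<open>S\<close>.
\<close>

section \<open>Averages over affine maps and the operator \<open>affine_law\<close>\<close>

text \<open>The function \<open>h\<close> of the proof idea; the pair \<open>x\<close> stands for
  the affine map with slope \<open>fst x\<close> and intercept \<open>snd x\<close>. With values of
  \<open>f\<close> in \<open>ennreal\<close>, every average exists without an integrability
  condition.\<close>

definition affine_avg :: "real measure \<Rightarrow> (real \<Rightarrow> ennreal) \<Rightarrow> real \<times> real \<Rightarrow> ennreal" where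
  "affine_avg \<mu> f x = (\<integral>\<^sup>+ s. f (fst x * s + snd x) \<partial>\<mu>)"

lemma measurable_affine_avg:
  assumes "prob_space \<mu>" and [measurable_cong]: "sets \<mu> = sets borel"
    and [measurable]: "f \<in> borel_measurable borel"
  shows "affine_avg \<mu> f \<in> borel_measurable (borel \<Otimes>\<^sub>M borel)"
proof -
  interpret prob_space \<mu> by fact
  show ?thesis
    unfolding affine_avg_def by measurable
qed

lemma affine_avg_le_1:
  assumes "prob_space \<mu>" "\<And>x. f x \<le> 1"
  shows "affine_avg \<mu> f x \<le> 1"
proof -
  interpret prob_space \<mu> by fact
  have "affine_avg \<mu> f x \<le> (\<integral>\<^sup>+ s. 1 \<partial>\<mu>)"
    unfolding affine_avg_def by (intro nn_integral_mono assms)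
  then show ?thesis by (simp add: emeasure_space_1)
qed

lemma measurable_affine_eval [measurable]:
  "(\<lambda>((u, v), x). u * x + v) \<in> borel_measurable ((borel \<Otimes>\<^sub>M borel) \<Otimes>\<^sub>M (borel :: real measure))"
  unfolding case_prod_unfold by measurable

lemma sets_affine_law [simp, measurable_cong]: "sets (affine_law \<nu> \<mu>) = sets borel"
  by (simp add: affine_law_def)

lemma prob_space_affine_law:
  assumes "prob_space \<nu>" "prob_space \<mu>"
    and [measurable_cong]: "sets \<nu> = sets (borel \<Otimes>\<^sub>M borel)" "sets \<mu> = sets borel"
  shows "prob_space (affine_law \<nu> \<mu>)"
proof -
  interpret pair_prob_space \<nu> \<mu>
    using assms(1,2) by (simp add: pair_prob_space_def pair_sigma_finite_def prob_space_imp_sigma_finite)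
  show ?thesis
    unfolding affine_law_def by (rule prob_space_distr) measurable
qed

lemma nn_integral_affine_law:
  assumes "prob_space \<mu>"
    and [measurable_cong]: "sets \<nu> = sets (borel \<Otimes>\<^sub>M borel)" "sets \<mu> = sets borel"
    and [measurable]: "f \<in> borel_measurable borel"
  shows "(\<integral>\<^sup>+ s. f s \<partial>affine_law \<nu> \<mu>) = (\<integral>\<^sup>+ y. affine_avg \<mu> f y \<partial>\<nu>)"
proof -
  interpret prob_space \<mu> by fact
  have "(\<integral>\<^sup>+ s. f s \<partial>affine_law \<nu> \<mu>) = (\<integral>\<^sup>+ z. f (fst (fst z) * snd z + snd (fst z)) \<partial>(\<nu> \<Otimes>\<^sub>M \<mu>))"
    unfolding affine_law_def by (subst nn_integral_distr) (auto simp: case_prod_unfold)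
  also have "\<dots> = (\<integral>\<^sup>+ y. \<integral>\<^sup>+ x. f (fst y * x + snd y) \<partial>\<mu> \<partial>\<nu>)"
    by (subst nn_integral_fst[symmetric]) auto
  finally show ?thesis by (simp add: affine_avg_def)
qed

text \<open>The map \<open>y\<close> is applied first, so new pairs enter on the inside, as in the
  backward iteration \<open>Rstar\<close>.\<close>

definition affine_comp :: "real \<times> real \<Rightarrow> real \<times> real \<Rightarrow> real \<times> real" where
  "affine_comp x y = (fst x * fst y, fst x * snd y + snd x)"

lemma measurable_affine_comp [measurable]:
  assumes [measurable]: "f \<in> M \<rightarrow>\<^sub>M borel \<Otimes>\<^sub>M borel" "g \<in> M \<rightarrow>\<^sub>M borel \<Otimes>\<^sub>M borel"
  shows "(\<lambda>z. affine_comp (f z) (g z)) \<in> M \<rightarrow>\<^sub>M borel \<Otimes>\<^sub>M borel"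
  unfolding affine_comp_def by measurable

text \<open>Obtained by using \<open>f\<close> after the map \<open>x\<close> as the test function.
  For a fixed point \<mu> of \<open>affine_law \<nu>\<close> it says that
  \<open>affine_avg \<mu> f\<close> is harmonic under composition with a random map of law
  \<nu>.\<close>

lemma affine_avg_affine_law:
  assumes "prob_space \<mu>"
    and [measurable_cong]: "sets \<nu> = sets (borel \<Otimes>\<^sub>M borel)" "sets \<mu> = sets borel"
    and [measurable]: "f \<in> borel_measurable borel"
  shows "affine_avg (affine_law \<nu> \<mu>) f x = (\<integral>\<^sup>+ y. affine_avg \<mu> f (affine_comp x y) \<partial>\<nu>)"
  using nn_integral_affine_law[of \<mu> \<nu> "\<lambda>s. f (fst x * s + snd x)", OF assms(1-3)]
  by (simp add: affine_avg_def affine_comp_def algebra_simps)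

lemma indicator_ennreal_le_1: "indicator D x \<le> (1 :: ennreal)"
  by (simp add: indicator_def)

text \<open>Indicators are among these test functions and determine the measure; the bound 1 is what
  dominated convergence will use.\<close>

lemma real_measure_eqI_nn_integral:
  fixes \<mu> \<mu>' :: "real measure"
  assumes "sets \<mu> = sets borel" "sets \<mu>' = sets borel"
    and "\<And>f. f \<in> borel_measurable borel \<Longrightarrow> (\<And>x. f x \<le> 1) \<Longrightarrow> (\<integral>\<^sup>+ x. f x \<partial>\<mu>) = (\<integral>\<^sup>+ x. f x \<partial>\<mu>')"
  shows "\<mu> = \<mu>'"
proof (rule measure_eqI)
  fix D assume "D \<in> sets \<mu>"
  then show "emeasure \<mu> D = emeasure \<mu>' D"
    using assms(3)[of "indicator D"] assms(1,2) by (simp add: indicator_ennreal_le_1)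
qed (use assms in simp)

definition map_fst_law :: "(real \<Rightarrow> real) \<Rightarrow> (real \<times> real) measure \<Rightarrow> (real \<times> real) measure" where
  "map_fst_law g \<nu> = distr \<nu> (borel \<Otimes>\<^sub>M borel) (\<lambda>y. (g (fst y), snd y))"

lemma sets_map_fst_law [simp, measurable_cong]: "sets (map_fst_law g \<nu>) = sets (borel \<Otimes>\<^sub>M borel)"
  by (simp add: map_fst_law_def)

lemma prob_space_map_fst_law:
  assumes "prob_space \<nu>" and [measurable_cong]: "sets \<nu> = sets (borel \<Otimes>\<^sub>M borel)"
    and [measurable]: "g \<in> borel_measurable borel"
  shows "prob_space (map_fst_law g \<nu>)"
  unfolding map_fst_law_def by (intro prob_space.prob_space_distr assms(1)) measurable

text \<open>The one-step identity for a modified slope: a change of variables carries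
  \<open>g\<close> into the law, so that chains with slopes \<open>g A\<close> can still be driven
  by the original pairs.\<close>

lemma affine_avg_map_fst_law:
  assumes mu: "prob_space \<mu>" "sets \<mu> = sets borel"
    and nu [measurable_cong]: "sets \<nu> = sets (borel \<Otimes>\<^sub>M borel)"
    and f: "f \<in> borel_measurable borel" and g [measurable]: "g \<in> borel_measurable borel"
  shows "(\<integral>\<^sup>+ y. affine_avg \<mu> f (affine_comp x (g (fst y), snd y)) \<partial>\<nu>)
    = affine_avg (affine_law (map_fst_law g \<nu>) \<mu>) f x"
proof -
  have [measurable]: "affine_avg \<mu> f \<in> borel_measurable (borel \<Otimes>\<^sub>M borel)"
    by (rule measurable_affine_avg[OF mu f])
  have [measurable]: "affine_comp x \<in> borel \<Otimes>\<^sub>M borel \<rightarrow>\<^sub>M borel \<Otimes>\<^sub>M borel"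
    by (rule measurable_affine_comp[of "\<lambda>_. x" _ "\<lambda>y. y"]) (simp_all add: space_pair_measure)
  show ?thesis
    unfolding affine_avg_affine_law[OF mu(1) sets_map_fst_law mu(2) f]
    unfolding map_fst_law_def
    by (subst nn_integral_distr) auto
qed

section \<open>Chains of affine maps along a fixed sequence\<close>

text \<open>The start is the identity map. The step may depend on time, because both the stopping
  rule and the slope \<open>-A_-\<close> treat the first step separately.\<close>

primrec chain :: "(nat \<Rightarrow> real \<times> real \<Rightarrow> real \<times> real \<Rightarrow> real \<times> real) \<Rightarrow> nat \<Rightarrow> (nat \<Rightarrow> real \<times> real) \<Rightarrow> real \<times> real"
where
  "chain st 0 y = (1, 0)"
| "chain st (Suc n) y = st n (chain st n y) (y (Suc n))"

lemma chain_cong: "(\<And>k. 1 \<le> k \<Longrightarrow> k \<le> n \<Longrightarrow> y k = y' k) \<Longrightarrow> chain st n y = chain st n y'"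
  by (induction n) auto

lemma measurable_chain:
  assumes [measurable]: "\<And>k. case_prod (st k) \<in> (borel \<Otimes>\<^sub>M borel) \<Otimes>\<^sub>M (borel \<Otimes>\<^sub>M borel) \<rightarrow>\<^sub>M borel \<Otimes>\<^sub>M borel"
    and "\<And>k. 1 \<le> k \<Longrightarrow> k \<le> n \<Longrightarrow> (\<lambda>z. Y z k) \<in> M \<rightarrow>\<^sub>M borel \<Otimes>\<^sub>M borel"
  shows "(\<lambda>z. chain st n (Y z)) \<in> M \<rightarrow>\<^sub>M borel \<Otimes>\<^sub>M borel"
  using assms(2)
proof (induction n)
  case (Suc n)
  have [measurable]: "(\<lambda>z. chain st n (Y z)) \<in> M \<rightarrow>\<^sub>M borel \<Otimes>\<^sub>M borel"
    using Suc by simp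
  have [measurable]: "(\<lambda>z. Y z (Suc n)) \<in> M \<rightarrow>\<^sub>M borel \<Otimes>\<^sub>M borel"
    using Suc.prems by simp
  have "(\<lambda>z. case_prod (st n) (chain st n (Y z), Y z (Suc n))) \<in> M \<rightarrow>\<^sub>M borel \<Otimes>\<^sub>M borel"
    by measurable
  then show ?case by simp
qed simp

text \<open>The guard \<open>0 < n\<close> is there because the initial slope 1 is nonnegative,
  while \<open>N\<close> ranges over positive indices only.\<close>

definition stopped_step :: "nat \<Rightarrow> real \<times> real \<Rightarrow> real \<times> real \<Rightarrow> real \<times> real" where
  "stopped_step n x y = (if 0 < n \<and> 0 \<le> fst x then x else affine_comp x y)"

lemma measurable_stopped_step:
  "case_prod (stopped_step n) \<in> (borel \<Otimes>\<^sub>M borel) \<Otimes>\<^sub>M (borel \<Otimes>\<^sub>M borel) \<rightarrow>\<^sub>M borel \<Otimes>\<^sub>M borel"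
  unfolding stopped_step_def case_prod_unfold by measurable

lemma chain_stopped_after:
  "n \<le> m \<Longrightarrow> 0 < n \<Longrightarrow> 0 \<le> fst (chain stopped_step n y) \<Longrightarrow>
    chain stopped_step m y = chain stopped_step n y"
  by (induction m rule: dec_induct) (auto simp: stopped_step_def)

definition plus_step :: "nat \<Rightarrow> real \<times> real \<Rightarrow> real \<times> real \<Rightarrow> real \<times> real" where
  "plus_step n x y = affine_comp x (plus_part (fst y), snd y)"

text \<open>
  Step \<open>n\<close> of the chain uses the pair of index \<open>n + 1\<close>, so \<open>n = 0\<close> is the step with \<open>A\<^sub>1\<close>.
\<close>

definition minus_plus_step :: "nat \<Rightarrow> real \<times> real \<Rightarrow> real \<times> real \<Rightarrow> real \<times> real" where
  "minus_plus_step n x y =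
    affine_comp x (if n = 0 then - minus_part (fst y) else plus_part (fst y), snd y)"

lemma measurable_parts [measurable]:
  "plus_part \<in> borel_measurable borel" "minus_part \<in> borel_measurable borel"
  unfolding plus_part_def[abs_def] minus_part_def[abs_def] by measurable

lemma measurable_plus_step:
  "case_prod (plus_step n) \<in> (borel \<Otimes>\<^sub>M borel) \<Otimes>\<^sub>M (borel \<Otimes>\<^sub>M borel) \<rightarrow>\<^sub>M borel \<Otimes>\<^sub>M borel"
  unfolding plus_step_def case_prod_unfold by measurable

lemma measurable_minus_plus_step:
  "case_prod (minus_plus_step n) \<in> (borel \<Otimes>\<^sub>M borel) \<Otimes>\<^sub>M (borel \<Otimes>\<^sub>M borel) \<rightarrow>\<^sub>M borel \<Otimes>\<^sub>M borel"
  unfolding minus_plus_step_def case_prod_unfold by measurable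

text \<open>While the stopped slope \<open>p\<close> is negative,
  \<open>p * plus_part a = min 0 (p * a)\<close>, and the intercepts move alike. Once
  \<open>p\<close> is nonnegative, the stopped chain is frozen and the other chain has slope 0, so
  its intercept is frozen too.\<close>

lemma chain_minus_plus:
  "1 \<le> n \<Longrightarrow> chain minus_plus_step n y =
    (min 0 (fst (chain stopped_step n y)), snd (chain stopped_step n y))"
proof (induction n rule: dec_induct)
  case base
  then show ?case
    by (auto simp: minus_plus_step_def stopped_step_def affine_comp_def minus_part_def indicator_def)
next
  case (step n)
  then show ?case
    by (cases "chain stopped_step n y"; cases "y (Suc n)")
      (auto simp: minus_plus_step_def[of n] stopped_step_def[of n] affine_comp_def plus_part_def
        indicator_def min_def not_le mult_le_0_iff mult_less_0_iff zero_le_mult_iff)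
qed

section \<open>Expectations along chains driven by independent copies\<close>

locale iid_affine = prob_space P for P :: "'b measure" +
  fixes A B :: "nat \<Rightarrow> 'b \<Rightarrow> real" and \<nu> :: "(real \<times> real) measure"
  assumes iid: "iid_copies P A B \<nu>"
begin

definition Y :: "'b \<Rightarrow> nat \<Rightarrow> real \<times> real" where
  "Y \<omega> n = (A n \<omega>, B n \<omega>)"

lemma indep: "indep_vars (\<lambda>_. borel \<Otimes>\<^sub>M borel) (\<lambda>n \<omega>. Y \<omega> n) {1..}"
  using iid by (simp add: iid_copies_def Y_def)

lemma measurable_Y: "1 \<le> n \<Longrightarrow> (\<lambda>\<omega>. Y \<omega> n) \<in> P \<rightarrow>\<^sub>M borel \<Otimes>\<^sub>M borel"
  using indep by (auto simp: indep_vars_def)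

lemma distr_Y: "1 \<le> n \<Longrightarrow> distr P (borel \<Otimes>\<^sub>M borel) (\<lambda>\<omega>. Y \<omega> n) = \<nu>"
  using iid by (simp add: iid_copies_def Y_def joint_law_def)

lemma sets_nu [simp, measurable_cong]: "sets \<nu> = sets (borel \<Otimes>\<^sub>M borel)"
  using distr_Y[of 1] by auto

lemma prob_space_nu: "prob_space \<nu>"
  using prob_space_distr[OF measurable_Y, of 1] distr_Y[of 1] by simp

text \<open>One-step Markov property: the state at time \<open>n\<close> is a function of the pairs
  1 to \<open>n\<close>, hence independent of pair \<open>n + 1\<close>, and Fubini integrates out
  the latter.\<close>

lemma nn_integral_chain_Suc:
  assumes st: "\<And>k. case_prod (st k) \<in> (borel \<Otimes>\<^sub>M borel) \<Otimes>\<^sub>M (borel \<Otimes>\<^sub>M borel) \<rightarrow>\<^sub>M borel \<Otimes>\<^sub>M borel"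
    and h [measurable]: "h \<in> borel_measurable (borel \<Otimes>\<^sub>M borel)"
  shows "(\<integral>\<^sup>+ \<omega>. h (chain st (Suc n) (Y \<omega>)) \<partial>P)
    = (\<integral>\<^sup>+ \<omega>. \<integral>\<^sup>+ y. h (st n (chain st n (Y \<omega>)) y) \<partial>\<nu> \<partial>P)"
proof -
  note [measurable] = st
  let ?X = "\<lambda>\<omega>. chain st n (Y \<omega>)"
  have X [measurable]: "?X \<in> P \<rightarrow>\<^sub>M borel \<Otimes>\<^sub>M borel"
    by (rule measurable_chain[OF st]) (auto intro: measurable_Y)
  have [measurable]: "(\<lambda>\<omega>. Y \<omega> (Suc n)) \<in> P \<rightarrow>\<^sub>M borel \<Otimes>\<^sub>M borel"
    by (rule measurable_Y) simp
  interpret nu: prob_space \<nu> by (rule prob_space_nu)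
  have "indep_var (PiM {1..n} (\<lambda>_. borel \<Otimes>\<^sub>M borel)) (\<lambda>\<omega>. restrict (Y \<omega>) {1..n})
      (PiM {Suc n} (\<lambda>_. borel \<Otimes>\<^sub>M borel)) (\<lambda>\<omega>. restrict (Y \<omega>) {Suc n})"
    by (rule indep_var_restrict[OF indep]) auto
  then have "indep_var (borel \<Otimes>\<^sub>M borel) (chain st n \<circ> (\<lambda>\<omega>. restrict (Y \<omega>) {1..n}))
      (borel \<Otimes>\<^sub>M borel) ((\<lambda>y. y (Suc n)) \<circ> (\<lambda>\<omega>. restrict (Y \<omega>) {Suc n}))"
    by (rule indep_var_compose) (auto intro!: measurable_chain[OF st, where Y = "\<lambda>z. z"])
  \<comment> \<open>Restriction makes the sequence \<open>undefined\<close> outside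
    \<open>{1..n}\<close>, where the chain never looks.\<close>
  moreover have "chain st n \<circ> (\<lambda>\<omega>. restrict (Y \<omega>) {1..n}) = ?X"
    by (auto simp: fun_eq_iff intro: chain_cong)
  ultimately have "indep_var (borel \<Otimes>\<^sub>M borel) ?X (borel \<Otimes>\<^sub>M borel) (\<lambda>\<omega>. Y \<omega> (Suc n))"
    by (simp add: comp_def)
  then have eq: "distr P ((borel \<Otimes>\<^sub>M borel) \<Otimes>\<^sub>M (borel \<Otimes>\<^sub>M borel)) (\<lambda>\<omega>. (?X \<omega>, Y \<omega> (Suc n)))
      = distr P (borel \<Otimes>\<^sub>M borel) ?X \<Otimes>\<^sub>M \<nu>"
    by (simp add: indep_var_distribution_eq distr_Y)
  have "(\<integral>\<^sup>+ \<omega>. h (chain st (Suc n) (Y \<omega>)) \<partial>P)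
      = (\<integral>\<^sup>+ z. h (case_prod (st n) z) \<partial>(distr P (borel \<Otimes>\<^sub>M borel) ?X \<Otimes>\<^sub>M \<nu>))"
    unfolding eq[symmetric] by (subst nn_integral_distr) auto
  also have "\<dots> = (\<integral>\<^sup>+ x. \<integral>\<^sup>+ y. h (st n x y) \<partial>\<nu> \<partial>distr P (borel \<Otimes>\<^sub>M borel) ?X)"
    by (subst nu.nn_integral_fst[symmetric]) auto
  also have "\<dots> = (\<integral>\<^sup>+ \<omega>. \<integral>\<^sup>+ y. h (st n (chain st n (Y \<omega>)) y) \<partial>\<nu> \<partial>P)"
    by (subst nn_integral_distr) auto
  finally show ?thesis .
qed

text \<open>A martingale has constant expectation. The time index of \<open>h\<close> accommodates a
  special first step and, in the existence proof for \<open>S\<close>, a count of the steps that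
  remain.\<close>

lemma nn_integral_chain_harmonic:
  assumes st: "\<And>k. case_prod (st k) \<in> (borel \<Otimes>\<^sub>M borel) \<Otimes>\<^sub>M (borel \<Otimes>\<^sub>M borel) \<rightarrow>\<^sub>M borel \<Otimes>\<^sub>M borel"
    and "\<And>k. k \<le> n \<Longrightarrow> h k \<in> borel_measurable (borel \<Otimes>\<^sub>M borel)"
    and "\<And>k x. k < n \<Longrightarrow> (\<integral>\<^sup>+ y. h (Suc k) (st k x y) \<partial>\<nu>) = h k x"
  shows "(\<integral>\<^sup>+ \<omega>. h n (chain st n (Y \<omega>)) \<partial>P) = h 0 (1, 0)"
  using assms(2,3)
proof (induction n)
  case 0
  then show ?case by (simp add: emeasure_space_1)
next
  case (Suc n)
  have "(\<integral>\<^sup>+ \<omega>. h (Suc n) (chain st (Suc n) (Y \<omega>)) \<partial>P) = (\<integral>\<^sup>+ \<omega>. h n (chain st n (Y \<omega>)) \<partial>P)"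
    using Suc.prems by (subst nn_integral_chain_Suc[OF st]) auto
  then show ?case using Suc by simp
qed

text \<open>The chain eventually equals its limit rather than merely approaching it, so dominated
  convergence applies to any measurable \<open>h\<close> bounded by 1, continuous or not.\<close>

lemma nn_integral_chain_limit:
  assumes st: "\<And>k. case_prod (st k) \<in> (borel \<Otimes>\<^sub>M borel) \<Otimes>\<^sub>M (borel \<Otimes>\<^sub>M borel) \<rightarrow>\<^sub>M borel \<Otimes>\<^sub>M borel"
    and h [measurable]: "h \<in> borel_measurable (borel \<Otimes>\<^sub>M borel)" and le: "\<And>x. h x \<le> (1::ennreal)"
    and X [measurable]: "X \<in> P \<rightarrow>\<^sub>M borel \<Otimes>\<^sub>M borel"
    and ev: "AE \<omega> in P. \<forall>\<^sub>F n in sequentially. chain st n (Y \<omega>) = X \<omega>"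
  shows "(\<lambda>n. \<integral>\<^sup>+ \<omega>. h (chain st n (Y \<omega>)) \<partial>P) \<longlonglongrightarrow> (\<integral>\<^sup>+ \<omega>. h (X \<omega>) \<partial>P)"
proof (rule nn_integral_dominated_convergence[where w = "\<lambda>_. 1"])
  have [measurable]: "(\<lambda>\<omega>. chain st n (Y \<omega>)) \<in> P \<rightarrow>\<^sub>M borel \<Otimes>\<^sub>M borel" for n
    by (rule measurable_chain[OF st]) (auto intro: measurable_Y)
  show "(\<lambda>\<omega>. h (chain st n (Y \<omega>))) \<in> borel_measurable P" for n
    by measurable
  show "(\<lambda>\<omega>. h (X \<omega>)) \<in> borel_measurable P"
    by measurable
  show "AE \<omega> in P. (\<lambda>n. h (chain st n (Y \<omega>))) \<longlonglongrightarrow> h (X \<omega>)"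
    using ev
  proof eventually_elim
    case (elim \<omega>)
    then have "\<forall>\<^sub>F n in sequentially. h (chain st n (Y \<omega>)) = h (X \<omega>)"
      by eventually_elim simp
    then show ?case by (rule tendsto_eventually)
  qed
qed (auto simp: le emeasure_space_1)

section \<open>Finiteness of the stopping time and the stopped chain\<close>

text \<open>By independence, a run of \<open>k\<close> nonnegative slopes has probability
  \<open>q ^ k\<close> with \<open>q < 1\<close>. The index is at least 2 so that a nonempty product
  precedes the negative factor; see \<open>stop_time_attained\<close>.\<close>

lemma AE_ex_neg:
  assumes "measure \<nu> {y \<in> space \<nu>. fst y < 0} > 0"
  shows "AE \<omega> in P. \<exists>n\<ge>2. A n \<omega> < 0"
proof -
  interpret nu: prob_space \<nu> by (rule prob_space_nu)
  have sp: "space \<nu> = UNIV"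
    using sets_eq_imp_space_eq[OF sets_nu] by (simp add: space_pair_measure)
  define q where "q = measure \<nu> {y. 0 \<le> fst y}"
  have "{y \<in> space (borel \<Otimes>\<^sub>M borel). fst y < 0} \<in> sets (borel \<Otimes>\<^sub>M (borel :: real measure) :: (real \<times> real) measure)"
    by measurable
  then have [measurable]: "{y. fst y < 0} \<in> sets (borel \<Otimes>\<^sub>M (borel :: real measure) :: (real \<times> real) measure)"
    by (simp add: space_pair_measure)
  have "{y \<in> space (borel \<Otimes>\<^sub>M borel). 0 \<le> fst y} \<in> sets (borel \<Otimes>\<^sub>M (borel :: real measure) :: (real \<times> real) measure)"
    by measurable
  then have [measurable]: "{y. 0 \<le> fst y} \<in> sets (borel \<Otimes>\<^sub>M (borel :: real measure) :: (real \<times> real) measure)"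
    by (simp add: space_pair_measure)
  have "q = 1 - measure \<nu> {y \<in> space \<nu>. fst y < 0}"
    unfolding q_def by (subst nu.prob_compl[symmetric]) (auto simp: sp intro!: arg_cong[where f="measure \<nu>"])
  then have q: "0 \<le> q" "q < 1"
    using assms by (auto simp: q_def)
  let ?E = "\<lambda>n. (\<lambda>\<omega>. Y \<omega> n) -` {y. 0 \<le> fst y} \<inter> space P"
  have E: "prob (?E n) = q" if "1 \<le> n" for n
    using that by (simp add: q_def measure_distr measurable_Y flip: distr_Y[OF that])
  have Em: "?E n \<in> events" if "1 \<le> n" for n
    using that by (intro measurable_sets[OF measurable_Y]) auto
  \<comment> \<open>The index set has \<open>k + 1\<close> elements; it is never empty, as an empty
    intersection would be \<open>UNIV\<close> instead of \<open>space P\<close>.\<close>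
  have bnd: "prob (\<Inter>n\<in>{2..<k+3}. ?E n) \<le> q ^ Suc k" for k
  proof -
    have "prob (\<Inter>n\<in>{2..<k+3}. ?E n) = (\<Prod>n\<in>{2..<k+3}. prob (?E n))"
      by (rule indep_varsD[OF indep]) auto
    also have "\<dots> = (\<Prod>n\<in>{2..<k+3}. q)"
      by (intro prod.cong E) auto
    finally show ?thesis by simp
  qed
  let ?Z = "\<Inter>n\<in>{2..}. ?E n"
  have Z: "?Z \<in> events"
    by (intro sets.countable_INT' image_subsetI Em) auto
  have "prob ?Z \<le> q ^ Suc k" for k
  proof (rule order.trans[OF finite_measure_mono bnd])
    show "(\<Inter>n\<in>{2..<k+3}. ?E n) \<in> events"
      by (intro sets.finite_INT Em) auto
  qed auto
  moreover have "(\<lambda>k. q ^ Suc k) \<longlonglongrightarrow> 0"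
    using q by (intro LIMSEQ_Suc LIMSEQ_power_zero) auto
  ultimately have "prob ?Z \<le> 0"
    by (intro LIMSEQ_le_const) auto
  then have "prob ?Z = 0"
    by (simp add: measure_le_0_iff)
  then have "?Z \<in> null_sets P"
    using Z by (simp add: null_sets_def emeasure_eq_measure)
  then show ?thesis
    by (rule AE_I') (auto simp: Y_def not_less)
qed

lemma affine_comp_Pi_Rstar:
  "affine_comp (Pi_n A n \<omega>, Rstar A B n \<omega>) (Y \<omega> (Suc n)) = (Pi_n A (Suc n) \<omega>, Rstar A B (Suc n) \<omega>)"
  by (simp add: affine_comp_def Pi_n_def Rstar_def Y_def atLeastLessThanSuc_atLeastAtMost)

text \<open>The step into time \<open>n\<close> inspects the slope at time \<open>n - 1\<close>, so
  negativity strictly before \<open>n\<close> is enough and the lemma applies at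
  \<open>n = N\<close> itself.\<close>

lemma chain_stopped_before:
  "(\<And>k. 1 \<le> k \<Longrightarrow> k < n \<Longrightarrow> Pi_n A k \<omega> < 0) \<Longrightarrow>
    chain stopped_step n (Y \<omega>) = (Pi_n A n \<omega>, Rstar A B n \<omega>)"
proof (induction n)
  case 0
  then show ?case by (simp add: Pi_n_def Rstar_def)
next
  case (Suc n)
  then have "chain stopped_step n (Y \<omega>) = (Pi_n A n \<omega>, Rstar A B n \<omega>)" "0 < n \<Longrightarrow> Pi_n A n \<omega> < 0"
    by auto
  then show ?case
    using affine_comp_Pi_Rstar[of n \<omega>] by (auto simp: stopped_step_def[of n])
qed

text \<open>If all products were negative, a negative factor at \<open>n \<ge> 2\<close> would turn
  the negative product at \<open>n - 1\<close> into a positive one at \<open>n\<close>. Hence the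
  infimum is over a nonempty set and the default value 0 does not occur.\<close>

lemma stop_time_attained:
  assumes "\<exists>n\<ge>2. A n \<omega> < 0"
  shows "1 \<le> stop_time A \<omega>" "0 \<le> Pi_n A (stop_time A \<omega>) \<omega>"
    and "\<And>k. 1 \<le> k \<Longrightarrow> k < stop_time A \<omega> \<Longrightarrow> Pi_n A k \<omega> < 0"
proof -
  let ?T = "{n. 1 \<le> n \<and> 0 \<le> Pi_n A n \<omega>}"
  have "?T \<noteq> {}"
  proof
    assume "?T = {}"
    then have neg: "Pi_n A n \<omega> < 0" if "1 \<le> n" for n
      using that by (force simp: not_le[symmetric])
    obtain n where n: "n \<ge> 2" "A n \<omega> < 0"
      using assms by auto
    then obtain m where m: "n = Suc m" "1 \<le> m"
      by (cases n) auto
    have "Pi_n A n \<omega> = Pi_n A m \<omega> * A n \<omega>"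
      by (simp add: m Pi_n_def)
    also have "\<dots> > 0"
      using neg[OF m(2)] n(2) by (rule mult_neg_neg)
    finally show False
      using neg[of n] n(1) by simp
  qed
  from Inf_nat_def1[OF this] show "1 \<le> stop_time A \<omega>" "0 \<le> Pi_n A (stop_time A \<omega>) \<omega>"
    by (auto simp: stop_time_def)
  show "Pi_n A k \<omega> < 0" if "1 \<le> k" "k < stop_time A \<omega>" for k
    using that cInf_lower[of k ?T] by (force simp: stop_time_def not_le[symmetric])
qed

lemma chain_stopped_eq:
  assumes "\<exists>n\<ge>2. A n \<omega> < 0" "stop_time A \<omega> \<le> n"
  shows "chain stopped_step n (Y \<omega>) = (Pi_n A (stop_time A \<omega>) \<omega>, Rstar A B (stop_time A \<omega>) \<omega>)"
  using chain_stopped_after[OF assms(2), of "Y \<omega>"] chain_stopped_before[of "stop_time A \<omega>" \<omega>]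
    stop_time_attained[OF assms(1)] by simp

lemma measurable_A: "1 \<le> n \<Longrightarrow> A n \<in> borel_measurable P"
  and measurable_B: "1 \<le> n \<Longrightarrow> B n \<in> borel_measurable P"
  using measurable_fst'[OF measurable_Y, of n] measurable_snd'[OF measurable_Y, of n]
  by (simp_all add: Y_def)

lemma measurable_Pi_n [measurable]: "Pi_n A n \<in> borel_measurable P"
  unfolding Pi_n_def[abs_def] by (intro borel_measurable_prod measurable_A) auto

lemma measurable_Rstar [measurable]: "Rstar A B n \<in> borel_measurable P"
  unfolding Rstar_def[abs_def]
  by (intro borel_measurable_sum borel_measurable_times borel_measurable_prod measurable_A measurable_B) auto

lemma measurable_stop_time [measurable]: "stop_time A \<in> P \<rightarrow>\<^sub>M count_space UNIV"
  unfolding stop_time_def[abs_def] Inf_nat_def mem_Collect_eq by measurable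

lemma measurable_stopped [measurable]:
  "(\<lambda>\<omega>. Pi_n A (stop_time A \<omega>) \<omega>) \<in> borel_measurable P"
  "(\<lambda>\<omega>. Rstar A B (stop_time A \<omega>) \<omega>) \<in> borel_measurable P"
  by (rule measurable_compose_countable; measurable)+

section \<open>Optional stopping: the equations for \<open>R\<close> and for the stopped sum\<close>

lemma solves_affine_stopped:
  assumes neg: "measure \<nu> {y \<in> space \<nu>. fst y < 0} > 0" and sol: "solves_affine \<nu> \<mu>"
  shows "solves_affine
    (joint_law P (\<lambda>\<omega>. Pi_n A (stop_time A \<omega>) \<omega>) (\<lambda>\<omega>. Rstar A B (stop_time A \<omega>) \<omega>)) \<mu>"
    (is "solves_affine ?J \<mu>")
proof -
  interpret mu: real_distribution \<mu>
    using sol by (simp add: solves_affine_def)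
  interpret nu: prob_space \<nu> by (rule prob_space_nu)
  have mu: "prob_space \<mu>" "sets \<mu> = sets borel"
    by (simp_all add: mu.prob_space_axioms)
  let ?X = "\<lambda>\<omega>. (Pi_n A (stop_time A \<omega>) \<omega>, Rstar A B (stop_time A \<omega>) \<omega>)"
  have J: "sets ?J = sets (borel \<Otimes>\<^sub>M borel)"
    by (simp add: joint_law_def)
  have "\<mu> = affine_law ?J \<mu>"
  proof (rule real_measure_eqI_nn_integral)
    fix f :: "real \<Rightarrow> ennreal" assume f [measurable]: "f \<in> borel_measurable borel" and le: "\<And>x. f x \<le> 1"
    let ?h = "affine_avg \<mu> f"
    have h [measurable]: "?h \<in> borel_measurable (borel \<Otimes>\<^sub>M borel)"
      by (rule measurable_affine_avg[OF mu f])
    \<comment> \<open>The equation for \<mu> makes \<open>?h\<close> harmonic.\<close>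
    have harm: "(\<integral>\<^sup>+ y. ?h (affine_comp x y) \<partial>\<nu>) = ?h x" for x
      using affine_avg_affine_law[OF mu(1) sets_nu mu(2) f, of x] sol by (simp add: solves_affine_def)
    have "(\<integral>\<^sup>+ y. ?h (stopped_step k x y) \<partial>\<nu>) = ?h x" for k x
    proof (cases "0 < k \<and> 0 \<le> fst x")
      case False
      then have "stopped_step k x = affine_comp x"
        by (auto simp: stopped_step_def fun_eq_iff)
      then show ?thesis by (simp add: harm)
    qed (simp add: stopped_step_def nu.emeasure_space_1)
    then have "(\<integral>\<^sup>+ \<omega>. ?h (chain stopped_step n (Y \<omega>)) \<partial>P) = ?h (1, 0)" for n
      by (intro nn_integral_chain_harmonic[OF measurable_stopped_step, where h = "\<lambda>_. ?h"]) auto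
    moreover have "(\<lambda>n. \<integral>\<^sup>+ \<omega>. ?h (chain stopped_step n (Y \<omega>)) \<partial>P) \<longlonglongrightarrow> (\<integral>\<^sup>+ \<omega>. ?h (?X \<omega>) \<partial>P)"
    proof (rule nn_integral_chain_limit[OF measurable_stopped_step h])
      show "AE \<omega> in P. \<forall>\<^sub>F n in sequentially. chain stopped_step n (Y \<omega>) = ?X \<omega>"
        using AE_ex_neg[OF neg]
        by eventually_elim (auto intro!: eventually_sequentiallyI[of "stop_time A _"] chain_stopped_eq)
    qed (auto intro: affine_avg_le_1[OF mu(1) le])
    \<comment> \<open>At the identity map \<open>(1, 0)\<close> the average is the integral of
      \<open>f\<close> under \<mu>.\<close>
    ultimately have "?h (1, 0) = (\<integral>\<^sup>+ \<omega>. ?h (?X \<omega>) \<partial>P)"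
      by (simp add: LIMSEQ_const_iff)
    also have "\<dots> = (\<integral>\<^sup>+ y. ?h y \<partial>?J)"
      unfolding joint_law_def by (subst nn_integral_distr) auto
    also have "\<dots> = (\<integral>\<^sup>+ s. f s \<partial>affine_law ?J \<mu>)"
      by (rule nn_integral_affine_law[OF mu(1) J mu(2) f, symmetric])
    finally show "(\<integral>\<^sup>+ s. f s \<partial>\<mu>) = (\<integral>\<^sup>+ s. f s \<partial>affine_law ?J \<mu>)"
      by (simp add: affine_avg_def)
  qed (use mu in auto)
  then show ?thesis
    using sol by (simp add: solves_affine_def)
qed

text \<open>The martingale argument for the chain of \<open>chain_minus_plus\<close>, whose limit
  has slope 0: there the average over \<sigma> collapses to \<open>f\<close> at the stopped
  sum.\<close>

lemma distr_Rstar: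
  assumes neg: "measure \<nu> {y \<in> space \<nu>. fst y < 0} > 0" and sol: "solves_affine (map_fst_law plus_part \<nu>) \<sigma>"
  shows "distr P borel (\<lambda>\<omega>. Rstar A B (stop_time A \<omega>) \<omega>) = affine_law (map_fst_law (\<lambda>a. - minus_part a) \<nu>) \<sigma>"
    (is "?L = affine_law ?J \<sigma>")
proof (rule real_measure_eqI_nn_integral)
  interpret si: real_distribution \<sigma>
    using sol by (simp add: solves_affine_def)
  have si: "prob_space \<sigma>" "sets \<sigma> = sets borel"
    by (simp_all add: si.prob_space_axioms)
  have m [measurable]: "(\<lambda>a. - minus_part a) \<in> borel_measurable borel"
    by measurable
  have J: "prob_space (affine_law ?J \<sigma>)" "sets (affine_law ?J \<sigma>) = sets borel"
    by (auto intro!: prob_space_affine_law prob_space_map_fst_law prob_space_nu si)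
  fix f :: "real \<Rightarrow> ennreal" assume f [measurable]: "f \<in> borel_measurable borel" and le: "\<And>x. f x \<le> 1"
  \<comment> \<open>Before the first step, whose slope is \<open>-A_-\<close>, the average is over
    the claimed law; afterwards it is over \<sigma>, which the steps with slope \<open>A_+\<close>
    preserve.\<close>
  define h where "h k = (if k = 0 then affine_avg (affine_law ?J \<sigma>) f else affine_avg \<sigma> f)" for k :: nat
  have [measurable]: "affine_avg \<sigma> f \<in> borel_measurable (borel \<Otimes>\<^sub>M borel)"
    by (rule measurable_affine_avg[OF si f])
  have [measurable]: "h k \<in> borel_measurable (borel \<Otimes>\<^sub>M borel)" for k
    unfolding h_def using measurable_affine_avg[OF J f] by simp
  have harm: "(\<integral>\<^sup>+ y. h (Suc k) (minus_plus_step k x y) \<partial>\<nu>) = h k x" for k x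
    using affine_avg_map_fst_law[OF si sets_nu f m, of x] affine_avg_map_fst_law[OF si sets_nu f measurable_parts(1), of x] sol
    by (simp add: h_def minus_plus_step_def solves_affine_def)
  let ?X = "\<lambda>\<omega>. (0, Rstar A B (stop_time A \<omega>) \<omega>)"
  have hn: "(\<integral>\<^sup>+ \<omega>. h n (chain minus_plus_step n (Y \<omega>)) \<partial>P) = h 0 (1, 0)" for n
    by (rule nn_integral_chain_harmonic[OF measurable_minus_plus_step]) (auto simp: harm)
  \<comment> \<open>The special value of \<open>h\<close> at time 0 does not affect the
    limit.\<close>
  have "\<forall>\<^sub>F n in sequentially.
      (\<integral>\<^sup>+ \<omega>. affine_avg \<sigma> f (chain minus_plus_step n (Y \<omega>)) \<partial>P) = h 0 (1, 0)"
    using hn by (intro eventually_sequentiallyI[of 1]) (metis h_def not_one_le_zero)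
  then have "(\<lambda>n. \<integral>\<^sup>+ \<omega>. affine_avg \<sigma> f (chain minus_plus_step n (Y \<omega>)) \<partial>P) \<longlonglongrightarrow> h 0 (1, 0)"
    by (rule tendsto_eventually)
  moreover have "(\<lambda>n. \<integral>\<^sup>+ \<omega>. affine_avg \<sigma> f (chain minus_plus_step n (Y \<omega>)) \<partial>P)
      \<longlonglongrightarrow> (\<integral>\<^sup>+ \<omega>. affine_avg \<sigma> f (?X \<omega>) \<partial>P)"
  proof (rule nn_integral_chain_limit[OF measurable_minus_plus_step])
    show "AE \<omega> in P. \<forall>\<^sub>F n in sequentially. chain minus_plus_step n (Y \<omega>) = ?X \<omega>"
      using AE_ex_neg[OF neg]
    proof eventually_elim
      case (elim \<omega>)
      show ?case
      proof (rule eventually_sequentiallyI)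
        fix n assume "stop_time A \<omega> \<le> n"
        then show "chain minus_plus_step n (Y \<omega>) = ?X \<omega>"
          using stop_time_attained(1,2)[OF elim] chain_stopped_eq[OF elim, of n]
          by (simp add: chain_minus_plus)
      qed
    qed
  qed (auto intro: affine_avg_le_1[OF si(1) le])
  ultimately have "h 0 (1, 0) = (\<integral>\<^sup>+ \<omega>. affine_avg \<sigma> f (?X \<omega>) \<partial>P)"
    by (rule LIMSEQ_unique)
  then show "(\<integral>\<^sup>+ s. f s \<partial>?L) = (\<integral>\<^sup>+ s. f s \<partial>affine_law ?J \<sigma>)"
    using si.emeasure_space_1 by (simp add: h_def affine_avg_def nn_integral_distr)
qed auto

section \<open>Existence of a solution for \<open>S\<close>\<close>

text \<open>The backward chain stabilises at the first negative slope, which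
  \<open>plus_part\<close> sends to 0. Its intercept at time \<open>n\<close> has the law of
  \<open>n\<close> iterations of \<open>K\<close> from 0, so these laws converge, and the limit is
  shown to be fixed by \<open>K\<close>.\<close>

lemma ex_solves_affine_plus:
  assumes neg: "measure \<nu> {y \<in> space \<nu>. fst y < 0} > 0"
  shows "\<exists>\<sigma>. solves_affine (map_fst_law plus_part \<nu>) \<sigma>"
proof -
  define K where "K = affine_law (map_fst_law plus_part \<nu>)"
  define \<mu> where "\<mu> n = (K ^^ n) (return borel 0)" for n
  have mu_Suc: "\<mu> (Suc n) = K (\<mu> n)" for n
    by (simp add: \<mu>_def)
  have mu: "prob_space (\<mu> n)" "sets (\<mu> n) = sets borel" for n
  proof -
    have "prob_space (\<mu> n) \<and> sets (\<mu> n) = sets borel"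
      by (induction n)
        (auto simp: \<mu>_def K_def prob_space_return intro!: prob_space_affine_law prob_space_map_fst_law prob_space_nu)
    then show "prob_space (\<mu> n)" "sets (\<mu> n) = sets borel"
      by auto
  qed
  let ?c = "\<lambda>n \<omega>. chain plus_step n (Y \<omega>)"
  have [measurable]: "?c n \<in> P \<rightarrow>\<^sub>M borel \<Otimes>\<^sub>M borel" for n
    by (rule measurable_chain[OF measurable_plus_step]) (auto intro: measurable_Y)
  define S where "S \<omega> = lim (\<lambda>n. snd (?c n \<omega>))" for \<omega>
  have [measurable]: "S \<in> borel_measurable P"
    unfolding S_def by (rule borel_measurable_lim_metric) measurable
  have ev: "AE \<omega> in P. \<forall>\<^sub>F n in sequentially. ?c n \<omega> = (0, S \<omega>)"
    using AE_ex_neg[OF neg]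
  proof eventually_elim
    case (elim \<omega>)
    then obtain m where "A (Suc m) \<omega> < 0"
      by (metis One_nat_def Suc_1 Suc_le_D)
    then have 0: "fst (?c (Suc m) \<omega>) = 0"
      by (simp add: plus_step_def affine_comp_def plus_part_def Y_def)
    have eq: "?c n \<omega> = (0, snd (?c (Suc m) \<omega>))" if "Suc m \<le> n" for n
      using that
    proof (induction n rule: dec_induct)
      case base
      show ?case using 0 by (simp add: prod_eq_iff)
    next
      case (step n)
      then show ?case by (simp add: plus_step_def affine_comp_def)
    qed
    then have "(\<lambda>n. snd (?c n \<omega>)) \<longlonglongrightarrow> snd (?c (Suc m) \<omega>)"
      by (intro tendsto_eventually eventually_sequentiallyI[of "Suc m"]) (metis snd_conv)
    then have "S \<omega> = snd (?c (Suc m) \<omega>)"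
      unfolding S_def by (rule limI)
    then show ?case
      using eq by (intro eventually_sequentiallyI[of "Suc m"]) simp
  qed
  define \<sigma> where "\<sigma> = distr P borel S"
  have lim: "(\<lambda>n. \<integral>\<^sup>+ s. f s \<partial>\<mu> n) \<longlonglongrightarrow> (\<integral>\<^sup>+ s. f s \<partial>\<sigma>)"
    if f [measurable]: "f \<in> borel_measurable borel" and le: "\<And>x. f x \<le> 1" for f :: "real \<Rightarrow> ennreal"
  proof -
    have "(\<integral>\<^sup>+ \<omega>. f (snd (?c n \<omega>)) \<partial>P) = (\<integral>\<^sup>+ s. f s \<partial>\<mu> n)" for n
    proof -
      \<comment> \<open>At time \<open>k\<close> the average is over the law of the remaining
        \<open>n - k\<close> iterations. At \<open>k = n\<close> this is the point mass at 0, which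
        leaves the intercept; at \<open>k = 0\<close> the map is the identity, which leaves
        \<open>\<mu> n\<close>.\<close>
      have "(\<integral>\<^sup>+ \<omega>. affine_avg (\<mu> (n - n)) f (?c n \<omega>) \<partial>P) = affine_avg (\<mu> (n - 0)) f (1, 0)"
      proof (rule nn_integral_chain_harmonic[OF measurable_plus_step])
        fix k x assume "k < n"
        then have "n - k = Suc (n - Suc k)" by simp
        then show "(\<integral>\<^sup>+ y. affine_avg (\<mu> (n - Suc k)) f (plus_step k x y) \<partial>\<nu>) = affine_avg (\<mu> (n - k)) f x"
          using affine_avg_map_fst_law[OF mu sets_nu f measurable_parts(1), of "n - Suc k" x]
          by (simp only: mu_Suc plus_step_def K_def)
      qed (rule measurable_affine_avg[OF mu f])
      then show ?thesis
        by (simp add: affine_avg_def \<mu>_def nn_integral_return)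
    qed
    moreover have "(\<lambda>n. \<integral>\<^sup>+ \<omega>. f (snd (?c n \<omega>)) \<partial>P) \<longlonglongrightarrow> (\<integral>\<^sup>+ \<omega>. f (snd (0 :: real, S \<omega>)) \<partial>P)"
      by (rule nn_integral_chain_limit[OF measurable_plus_step _ _ _ ev]) (auto intro: le)
    ultimately show ?thesis
      by (simp add: \<sigma>_def nn_integral_distr)
  qed
  have si: "prob_space \<sigma>" "sets \<sigma> = sets borel"
    by (auto simp: \<sigma>_def intro!: prob_space_distr)
  have "\<sigma> = K \<sigma>"
  proof (rule real_measure_eqI_nn_integral)
    fix f :: "real \<Rightarrow> ennreal" assume f [measurable]: "f \<in> borel_measurable borel" and le: "\<And>x. f x \<le> 1"
    interpret np: prob_space "map_fst_law plus_part \<nu>"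
      by (intro prob_space_map_fst_law prob_space_nu) measurable
    \<comment> \<open>The image of \<open>f\<close> under the dual of \<open>K\<close>. It is again
      measurable and bounded by 1, so \<open>lim\<close> applies to it, and this replaces continuity
      of \<open>K\<close>.\<close>
    let ?g = "\<lambda>s. \<integral>\<^sup>+ y. f (fst y * s + snd y) \<partial>map_fst_law plus_part \<nu>"
    have g [measurable]: "?g \<in> borel_measurable borel"
      by measurable
    have "?g s \<le> (\<integral>\<^sup>+ y. 1 \<partial>map_fst_law plus_part \<nu>)" for s
      by (intro nn_integral_mono le)
    then have g1: "?g s \<le> 1" for s
      by (simp add: np.emeasure_space_1)
    have K: "(\<integral>\<^sup>+ s. f s \<partial>K m) = (\<integral>\<^sup>+ s. ?g s \<partial>m)" if m: "prob_space m" "sets m = sets borel" for m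
    proof -
      interpret pair_sigma_finite m "map_fst_law plus_part \<nu>"
        using m by (simp add: pair_sigma_finite_def prob_space_imp_sigma_finite np.sigma_finite_measure_axioms)
      note [measurable_cong] = m(2)
      have "(\<integral>\<^sup>+ s. f s \<partial>K m) = (\<integral>\<^sup>+ y. affine_avg m f y \<partial>map_fst_law plus_part \<nu>)"
        unfolding K_def by (rule nn_integral_affine_law[OF m(1) sets_map_fst_law m(2) f])
      also have "\<dots> = (\<integral>\<^sup>+ s. ?g s \<partial>m)"
        unfolding affine_avg_def by (rule Fubini') measurable
      finally show ?thesis .
    qed
    \<comment> \<open>The shifted sequence has two limits: directly through \<open>f\<close>, and
      through \<open>?g\<close> after moving one \<open>K\<close> to the test function.\<close>
    have "(\<lambda>n. \<integral>\<^sup>+ s. f s \<partial>\<mu> (Suc n)) \<longlonglongrightarrow> (\<integral>\<^sup>+ s. f s \<partial>\<sigma>)"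
      by (rule LIMSEQ_Suc[OF lim[OF f le]])
    moreover have "(\<lambda>n. \<integral>\<^sup>+ s. f s \<partial>\<mu> (Suc n)) \<longlonglongrightarrow> (\<integral>\<^sup>+ s. f s \<partial>K \<sigma>)"
      using lim[OF g g1] by (simp add: mu_Suc K mu si)
    ultimately show "(\<integral>\<^sup>+ s. f s \<partial>\<sigma>) = (\<integral>\<^sup>+ s. f s \<partial>K \<sigma>)"
      by (rule LIMSEQ_unique)
  qed (auto simp: si K_def)
  moreover have "real_distribution \<sigma>"
    unfolding \<sigma>_def by (rule real_distribution_distr) measurable
  ultimately show ?thesis
    by (auto simp: solves_affine_def K_def)
qed

end

section \<open>The three assertions for given random variables\<close>

text \<open>\<open>S\<close> enters only through its law \<sigma>. Existence of \<sigma> is a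
  separate conjunct, so that the formula for the stopped sum, claimed for every solution \<sigma>,
  is not vacuous.\<close>

theorem lemma5p1:
  fixes M :: "'a measure" and A B :: "'a \<Rightarrow> real"
    and P :: "'b measure" and An Bn :: "nat \<Rightarrow> 'b \<Rightarrow> real"
    and Q :: "'c measure" and R :: "'c \<Rightarrow> real"
  assumes "prob_space M" and "A \<in> borel_measurable M" and "B \<in> borel_measurable M"
    and "measure M {\<omega> \<in> space M. A \<omega> < 0} > 0"
    and "ext_expectation M (\<lambda>\<omega>. log_abs (A \<omega>)) < 0"
    and "ext_expectation M (\<lambda>\<omega>. max 0 (log_abs (B \<omega>))) < \<infinity>"
    and "prob_space P" and "iid_copies P An Bn (joint_law M A B)"
    and "prob_space Q" and "R \<in> borel_measurable Q"
    and "solves_affine (joint_law M A B) (distr Q borel R)"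
  defines "N \<equiv> stop_time An"
  defines "Pi_N \<equiv> (\<lambda>\<omega>. Pi_n An (N \<omega>) \<omega>)"
  defines "R_N \<equiv> (\<lambda>\<omega>. Rstar An Bn (N \<omega>) \<omega>)"
  defines "S_eq \<equiv> solves_affine (joint_law M (\<lambda>\<omega>. plus_part (A \<omega>)) B)"
  shows "solves_affine (joint_law P Pi_N R_N) (distr Q borel R) \<and>
         (\<exists>\<sigma>. S_eq \<sigma>) \<and>
         (\<forall>\<sigma>. S_eq \<sigma> \<longrightarrow>
            distr P borel R_N = affine_law (joint_law M (\<lambda>\<omega>. - minus_part (A \<omega>)) B) \<sigma>)"
proof -
  interpret M: prob_space M by fact
  note [measurable] = assms(2,3)
  interpret iid_affine P An Bn "joint_law M A B"
    using assms(7,8) by (simp add: iid_affine_def iid_affine_axioms_def)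
  have part: "map_fst_law g (joint_law M A B) = joint_law M (\<lambda>\<omega>. g (A \<omega>)) B" if [measurable]: "g \<in> borel_measurable borel" for g
    unfolding map_fst_law_def joint_law_def by (subst distr_distr) (auto simp: comp_def)
  have plus: "map_fst_law plus_part (joint_law M A B) = joint_law M (\<lambda>\<omega>. plus_part (A \<omega>)) B"
    and minus: "map_fst_law (\<lambda>a. - minus_part a) (joint_law M A B) = joint_law M (\<lambda>\<omega>. - minus_part (A \<omega>)) B"
    by (rule part, measurable)+
  have set: "{y \<in> space (borel \<Otimes>\<^sub>M borel). fst y < 0} \<in> sets (borel \<Otimes>\<^sub>M (borel :: real measure) :: (real \<times> real) measure)"
    by measurable
  have "measure (joint_law M A B) {y \<in> space (joint_law M A B). fst y < 0}
      = measure M {\<omega> \<in> space M. A \<omega> < 0}"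
    using set by (auto simp: joint_law_def measure_distr space_pair_measure intro!: arg_cong[where f = "measure M"])
  then have neg: "measure (joint_law M A B) {y \<in> space (joint_law M A B). fst y < 0} > 0"
    using assms(4) by simp
  show ?thesis
    unfolding N_def Pi_N_def R_N_def S_eq_def
    using solves_affine_stopped[OF neg assms(11)] ex_solves_affine_plus[OF neg] distr_Rstar[OF neg]
    unfolding plus minus by blast
qed

end
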